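(* Let $X$ be a rack, $F\in C^k(X;X)$ and $G\in C^m(X;X)$. Then $$\psi F\cup\psi G=\psi(F\cup PG)+(-1)^{k+1}\psi(PF\cup G)$$ as elements of $C^{k+m+2}(X)$.
   Context: A rack is a set $X$ with operation $*$ such that for all $a,b$ there is a unique $c$ with $a=c*b$, and $(a*b)*c=(a*c)*(b*c)$. Fix a commutative coefficient ring. $C^n(X)$ denotes functions on $X^n$ and $C^n(X;X)$ denotes functions on $X\times X^n$, whose elements are written $(y;x_1,\dots,x_n)$. Face maps: $\delta^0_i(y;x_1,\dots,x_n)=(y;x_1,\dots,x_{i-1},x_{i+1},\dots,x_n)$, $\delta^1_i(y;x_1,\dots,x_n)=(y*x_i;x_1*x_i,\dots,x_{i-1}*x_i,x_{i+1},\dots,x_n)$, and on $X^n$ the same formulas with $y$ omitted. Cup product (on $C^\bullet(X;X)$ and on $C^\bullet(X)$): for $f$ of degree $k$, $g$ of degree $m$, $n=k+m$, $(f\cup g)(z)=(-1)^{km}\sum_A\epsilon(A)f(\delta^0_Az)g(\delta^1_Bz)$, the sum over subsets $A=\{a_1<\dots<a_m\}\subseteq\{1,\dots,n\}$ with complement $B=\{b_1<\dots<b_k\}$; $\epsilon(A)$ is the sign of the permutation sending $(1,\dots,n)$ to $(b_1,\dots,b_k,a_1,\dots,a_m)$, $\delta^0_A=\delta^0_{a_1}\circ\dots\circ\delta^0_{a_m}$, $\delta^1_B=\delta^1_{b_1}\circ\dots\circ\delta^1_{b_k}$. $\psi\colon C^{n-1}(X;X)\to C^n(X)$ is $(\psi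 F)(x_1,\dots,x_n)=(-1)^{n-1}F(x_1;x_2,\dots,x_n)$ for $n>0$. $P\colon C^k(X;X)\to C^{k+1}(X;X)$ is $(PF)(x_0;x_1,\dots,x_{k+1})=(-1)^kF(x_1;x_2,\dots,x_{k+1})$. *)

theory Defs
  imports Complex_Main "HOL-Library.FuncSet" "HOL-Combinatorics.Permutations"
begin

locale rack =
  fixes X :: "'a set" and ast :: "'a \<Rightarrow> 'a \<Rightarrow> 'a" (infixl "\<triangleright>" 70)
  assumes closed: "\<lbrakk>a \<in> X; b \<in> X\<rbrakk> \<Longrightarrow> a \<triangleright> b \<in> X"
    and right_divisible: "\<lbrakk>a \<in> X; b \<in> X\<rbrakk> \<Longrightarrow> \<exists>!c. c \<in> X \<and> a = c \<triangleright> b"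
    and self_distributive:
      "\<lbrakk>a \<in> X; b \<in> X; c \<in> X\<rbrakk> \<Longrightarrow> (a \<triangleright> b) \<triangleright> c = (a \<triangleright> c) \<triangleright> (b \<triangleright> c)"

text \<open>
  The power $X^n$ is rendered by the lists of length $n$ over $X$; the entry $x_i$ of
  $(x_1, \dots, x_n)$ is \<open>xs ! (i - 1)\<close>. Elements $(y; x_1, \dots, x_n)$ of $X \times X^n$ are
  pairs \<open>(y, xs)\<close>.
\<close>

definition tuples :: "'a set \<Rightarrow> nat \<Rightarrow> 'a list set" where
  "tuples X n = {xs. set xs \<subseteq> X \<and> length xs = n}"

text \<open>
  Cochains are extensional functions (equal to \<^const>\<open>undefined\<close> off their domain), so that
  equality in HOL is equality of functions on $X^n$, respectively on $X \times X^n$.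
\<close>

definition cochains :: "'a set \<Rightarrow> nat \<Rightarrow> ('a list \<Rightarrow> 'r) set" where
  "cochains X n = tuples X n \<rightarrow>\<^sub>E UNIV"

definition cochains_coeff :: "'a set \<Rightarrow> nat \<Rightarrow> ('a \<times> 'a list \<Rightarrow> 'r) set" where
  "cochains_coeff X n = X \<times> tuples X n \<rightarrow>\<^sub>E UNIV"

definition face0 :: "nat \<Rightarrow> 'a list \<Rightarrow> 'a list" where
  "face0 i xs = take (i - 1) xs @ drop i xs"

definition face1 :: "('a \<Rightarrow> 'a \<Rightarrow> 'a) \<Rightarrow> nat \<Rightarrow> 'a list \<Rightarrow> 'a list" where
  "face1 ast i xs = map (\<lambda>x. ast x (xs ! (i - 1))) (take (i - 1) xs) @ drop i xs"

definition face0_coeff :: "nat \<Rightarrow> 'a \<times> 'a list \<Rightarrow> 'a \<times> 'a list" where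
  "face0_coeff i = (\<lambda>(y, xs). (y, face0 i xs))"

definition face1_coeff :: "('a \<Rightarrow> 'a \<Rightarrow> 'a) \<Rightarrow> nat \<Rightarrow> 'a \<times> 'a list \<Rightarrow> 'a \<times> 'a list" where
  "face1_coeff ast i = (\<lambda>(y, xs). (ast y (xs ! (i - 1)), face1 ast i xs))"

text \<open>
  For $A = \{a_1 < \dots < a_m\}$ this is $\delta_{a_1} \circ \dots \circ \delta_{a_m}$; the face
  with the largest index acts first.
\<close>

definition iterated_face :: "(nat \<Rightarrow> 'z \<Rightarrow> 'z) \<Rightarrow> nat set \<Rightarrow> 'z \<Rightarrow> 'z" where
  "iterated_face \<delta> A = foldr \<delta> (sorted_list_of_set A)"

definition shuffle_perm :: "nat \<Rightarrow> nat set \<Rightarrow> nat \<Rightarrow> nat" where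
  "shuffle_perm n A i =
    (if i \<in> {1..n}
     then (sorted_list_of_set ({1..n} - A) @ sorted_list_of_set A) ! (i - 1)
     else i)"

text \<open>
  The cup product formula is the same on $C^\bullet(X)$ and on $C^\bullet(X;X)$, so it is stated
  once, for a domain \<open>D\<close> of the product and two families of face maps; \<open>k\<close> and \<open>m\<close> are the
  degrees of \<open>f\<close> and \<open>g\<close>.
\<close>

definition cup_on ::
  "'z set \<Rightarrow> (nat \<Rightarrow> 'z \<Rightarrow> 'z) \<Rightarrow> (nat \<Rightarrow> 'z \<Rightarrow> 'z) \<Rightarrow> nat \<Rightarrow> nat \<Rightarrow>
    ('z \<Rightarrow> 'r::comm_ring_1) \<Rightarrow> ('z \<Rightarrow> 'r) \<Rightarrow> 'z \<Rightarrow> 'r" where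
  "cup_on D \<delta>0 \<delta>1 k m f g =
    (\<lambda>z\<in>D. (-1) ^ (k * m) *
      (\<Sum>A | A \<subseteq> {1..k + m} \<and> card A = m.
        of_int (sign (shuffle_perm (k + m) A)) *
        f (iterated_face \<delta>0 A z) * g (iterated_face \<delta>1 ({1..k + m} - A) z)))"

definition cup ::
  "'a set \<Rightarrow> ('a \<Rightarrow> 'a \<Rightarrow> 'a) \<Rightarrow> nat \<Rightarrow> nat \<Rightarrow>
    ('a list \<Rightarrow> 'r::comm_ring_1) \<Rightarrow> ('a list \<Rightarrow> 'r) \<Rightarrow> 'a list \<Rightarrow> 'r" where
  "cup X ast k m = cup_on (tuples X (k + m)) face0 (face1 ast) k m"

definition cup_coeff ::
  "'a set \<Rightarrow> ('a \<Rightarrow> 'a \<Rightarrow> 'a) \<Rightarrow> nat \<Rightarrow> nat \<Rightarrow>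
    ('a \<times> 'a list \<Rightarrow> 'r::comm_ring_1) \<Rightarrow> ('a \<times> 'a list \<Rightarrow> 'r) \<Rightarrow> 'a \<times> 'a list \<Rightarrow> 'r" where
  "cup_coeff X ast k m = cup_on (X \<times> tuples X (k + m)) face0_coeff (face1_coeff ast) k m"

text \<open>
  Both maps below are indexed by the degree \<open>k\<close> of their argument: \<open>psi X k\<close> maps
  $C^k(X;X)$ to $C^{k+1}(X)$ and \<open>pmap X k\<close> maps $C^k(X;X)$ to $C^{k+1}(X;X)$. The sign of
  $\psi$ is $(-1)^{n-1}$ for the degree $n = k + 1$ of its value.
\<close>

definition psi :: "'a set \<Rightarrow> nat \<Rightarrow> ('a \<times> 'a list \<Rightarrow> 'r::comm_ring_1) \<Rightarrow> 'a list \<Rightarrow> 'r" where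
  "psi X k F = (\<lambda>xs\<in>tuples X (k + 1). (-1) ^ k * F (hd xs, tl xs))"

definition pmap ::
  "'a set \<Rightarrow> nat \<Rightarrow> ('a \<times> 'a list \<Rightarrow> 'r::comm_ring_1) \<Rightarrow> 'a \<times> 'a list \<Rightarrow> 'r" where
  "pmap X k F = (\<lambda>(y, xs)\<in>X \<times> tuples X (k + 1). (-1) ^ k * F (hd xs, tl xs))"

lemma cup_in_cochains: "cup X ast k m f g \<in> cochains X (k + m)"
  by (simp add: cup_def cup_on_def cochains_def)

lemma cup_coeff_in_cochains_coeff: "cup_coeff X ast k m F G \<in> cochains_coeff X (k + m)"
  by (simp add: cup_coeff_def cup_on_def cochains_coeff_def)

lemma psi_in_cochains: "psi X k F \<in> cochains X (k + 1)"
  by (simp add: psi_def cochains_def)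

lemma pmap_in_cochains_coeff: "pmap X k F \<in> cochains_coeff X (k + 1)"
  by (simp add: pmap_def cochains_coeff_def)

lemma pmap_apply:
  assumes "x0 \<in> X" and "x # xs \<in> tuples X (k + 1)"
  shows "pmap X k F (x0, x # xs) = (-1) ^ k * F (x, xs)"
  using assms by (simp add: pmap_def)

end

theory Submission
  imports Defs
begin

text \<open>
  Read \<open>(x\<^sub>0; x\<^sub>1, \<dots>, x\<^sub>n)\<close> as the list \<open>x\<^sub>0 # [x\<^sub>1, \<dots>, x\<^sub>n]\<close>. Under this reading the \<open>i\<close>-th face
  map of $X \times X^n$ is the face map of $X^{n+1}$ with index \<open>i + 1\<close>, both face maps of
  $X^{n+1}$ with index \<open>1\<close> forget \<open>x\<^sub>0\<close>, and \<open>P\<close> is \<open>\<psi>\<close> followed by the pullback along the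
  projection that forgets \<open>x\<^sub>0\<close>.

  A subset of \<open>{1..n + 1}\<close> is either the shift by one of a subset \<open>A\<close> of \<open>{1..n}\<close>, or such a
  shift together with \<open>1\<close>. This splits the sum in $\psi F \cup \psi G$ in two. In the first part the index
  \<open>1\<close> belongs to the complement, so the argument of \<open>\<psi>G\<close> loses its \<open>x\<^sub>0\<close> and \<open>\<psi>G\<close> becomes \<open>PG\<close>:
  these are the terms of $\psi(F \cup PG)$. In the second part the argument of \<open>\<psi>F\<close> loses its \<open>x\<^sub>0\<close>:
  these are the terms of $\psi(PF \cup G)$. The shuffle of a shifted set has the sign of the
  original shuffle; if \<open>1\<close> is added to the set, then \<open>1\<close> moves past the \<open>k + 1\<close> entries of the
  complement, which gives the factor \<open>(-1)^(k + 1)\<close>. What remains is to compare powers of \<open>-1\<close>.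
\<close>

section \<open>Subsets of an initial segment and its shift\<close>

lemma sorted_list_of_set_Suc_image:
  assumes "finite A"
  shows "sorted_list_of_set (Suc ` A) = map Suc (sorted_list_of_set A)"
proof (rule sorted_distinct_set_unique)
  have "sorted (map Suc xs)" if "sorted xs" for xs
    using that by (simp add: sorted_map)
  then show "sorted (map Suc (sorted_list_of_set A))"
    by simp
qed (use assms in \<open>auto simp: distinct_map\<close>)

lemma sorted_list_of_set_insert_1_Suc_image:
  assumes "finite A" "0 \<notin> A"
  shows "sorted_list_of_set (insert 1 (Suc ` A)) = 1 # map Suc (sorted_list_of_set A)"
proof (rule sorted_distinct_set_unique)
  have "sorted (map Suc xs)" if "sorted xs" for xs
    using that by (simp add: sorted_map)
  then show "sorted (1 # map Suc (sorted_list_of_set A))"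
    using assms by auto
qed (use assms in \<open>auto simp: distinct_map simp del: sorted_list_of_set_insert_remove\<close>)

lemma atLeastAtMost_Suc_eq_insert_1: "{1..Suc n} = insert 1 (Suc ` {1..n})"
  by (auto simp: image_Suc_atLeastAtMost)

lemma atLeastAtMost_Suc_diff_Suc_image:
  "{1..Suc n} - Suc ` A = insert 1 (Suc ` ({1..n} - A))" if "A \<subseteq> {1..n}"
  unfolding atLeastAtMost_Suc_eq_insert_1
  using that by (auto simp del: image_Suc_atLeastAtMost)

lemma atLeastAtMost_Suc_diff_insert_1_Suc_image:
  "{1..Suc n} - insert 1 (Suc ` A) = Suc ` ({1..n} - A)"
  unfolding atLeastAtMost_Suc_eq_insert_1 by (auto simp del: image_Suc_atLeastAtMost)

lemma sum_subsets_card_Suc: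
  fixes h :: "nat set \<Rightarrow> 'b::comm_monoid_add"
  shows "(\<Sum>A | A \<subseteq> {1..Suc n} \<and> card A = Suc m. h A) =
    (\<Sum>A | A \<subseteq> {1..n} \<and> card A = Suc m. h (Suc ` A)) +
    (\<Sum>A | A \<subseteq> {1..n} \<and> card A = m. h (insert 1 (Suc ` A)))"
proof -
  let ?S = "\<lambda>l. {A. A \<subseteq> {1..n} \<and> card A = l}"
  let ?a = "\<lambda>A. Suc ` A" and ?b = "\<lambda>A. insert 1 (Suc ` A)"
  have fin: "finite (?S l)" for l
    by (rule finite_subset[of _ "Pow {1..n}"]) auto
  have no1: "1 \<notin> Suc ` A" if "A \<subseteq> {1..n}" for A
    using that by auto
  have card_b: "card (?b A) = Suc (card A)" if "A \<subseteq> {1..n}" for A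
    using that no1[OF that] finite_subset[OF that] by (simp add: card_image)
  have "{A. A \<subseteq> {1..Suc n} \<and> card A = Suc m} = ?a ` ?S (Suc m) \<union> ?b ` ?S m"
  proof (intro set_eqI iffI)
    fix A assume "A \<in> {A. A \<subseteq> {1..Suc n} \<and> card A = Suc m}"
    then have A: "A \<subseteq> {1..Suc n}" "card A = Suc m" by auto
    have "A - {1} \<subseteq> Suc ` {1..n}"
      using A(1) unfolding atLeastAtMost_Suc_eq_insert_1 by auto
    then obtain A' where A': "A' \<subseteq> {1..n}" "A - {1} = Suc ` A'"
      by (meson subset_imageE)
    show "A \<in> ?a ` ?S (Suc m) \<union> ?b ` ?S m"
    proof (cases "1 \<in> A")
      case True
      then have eq: "A = ?b A'" using A'(2) by auto
      then have "card A' = m" using A(2) card_b[OF A'(1)] by simp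
      then show ?thesis using eq A'(1) by auto
    next
      case False
      then have eq: "A = ?a A'" using A'(2) by auto
      then have "card A' = Suc m" using A(2) by (simp add: card_image)
      then show ?thesis using eq A'(1) by auto
    qed
  next
    fix A assume "A \<in> ?a ` ?S (Suc m) \<union> ?b ` ?S m"
    then show "A \<in> {A. A \<subseteq> {1..Suc n} \<and> card A = Suc m}"
    proof
      assume "A \<in> ?a ` ?S (Suc m)"
      then show ?thesis by (auto simp: card_image)
    next
      assume "A \<in> ?b ` ?S m"
      then obtain A' where "A' \<subseteq> {1..n}" "card A' = m" "A = ?b A'" by auto
      then show ?thesis using card_b[of A'] by auto
    qed
  qed
  moreover have "?a ` ?S (Suc m) \<inter> ?b ` ?S m = {}"
    using no1 by blast
  moreover have "inj_on ?a (?S (Suc m))"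
    by (auto simp: inj_on_def inj_image_eq_iff)
  moreover have "inj_on ?b (?S m)"
  proof (rule inj_onI)
    fix A B assume "A \<in> ?S m" "B \<in> ?S m" "?b A = ?b B"
    then have "Suc ` A = Suc ` B"
      using no1[of A] no1[of B] insert_ident[of 1 "Suc ` A" "Suc ` B"] by simp
    then show "A = B" by (simp add: inj_image_eq_iff)
  qed
  ultimately show ?thesis
    using fin by (simp add: sum.union_disjoint sum.reindex)
qed

section \<open>Signs of shuffles\<close>

lemma shuffle_perm_permutes:
  assumes "A \<subseteq> {1..n}"
  shows "shuffle_perm n A permutes {1..n}"
proof (rule bij_imp_permutes)
  let ?w = "sorted_list_of_set ({1..n} - A) @ sorted_list_of_set A"
  have fin: "finite A" using assms finite_subset by blast
  have set: "set ?w = {1..n}" and dist: "distinct ?w"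
    using assms fin by auto
  then have len: "length ?w = n"
    using distinct_card[of ?w] by simp
  have "bij_betw (\<lambda>i. i - 1) {1..n} {..<n}"
    by (rule bij_betw_byWitness[where f' = Suc]) auto
  moreover have "bij_betw ((!) ?w) {..<n} {1..n}"
    using bij_betw_nth[OF dist, of "{..<n}" "{1..n}"] set len by simp
  ultimately have "bij_betw ((!) ?w \<circ> (\<lambda>i. i - 1)) {1..n} {1..n}"
    by (rule bij_betw_trans)
  then show "bij_betw (shuffle_perm n A) {1..n} {1..n}"
    by (rule bij_betw_cong[THEN iffD1, rotated]) (simp add: shuffle_perm_def)
qed (auto simp: shuffle_perm_def)

definition shift_perm :: "(nat \<Rightarrow> nat) \<Rightarrow> nat \<Rightarrow> nat" where
  "shift_perm p i = (case i of 0 \<Rightarrow> 0 | Suc j \<Rightarrow> Suc (p j))"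

lemma shift_perm_id: "shift_perm id = id"
  by (auto simp: shift_perm_def fun_eq_iff split: nat.split)

lemma shift_perm_transpose_comp:
  "shift_perm (transpose a b \<circ> p) = transpose (Suc a) (Suc b) \<circ> shift_perm p"
  by (auto simp: shift_perm_def fun_eq_iff transpose_def split: nat.split)

text \<open>
  Shifting turns a product of transpositions into a product of the same number of transpositions.
\<close>

lemma shift_perm_permutation_sign:
  assumes "permutation p"
  shows "permutation (shift_perm p) \<and> sign (shift_perm p) = sign p"
proof -
  obtain S where "p permutes S" and fin: "finite S"
    using assms unfolding permutation_permutes by blast
  then show ?thesis
  proof (induction rule: permutes_induct)
    case id
    then show ?case unfolding shift_perm_id by simp
  next
    case (swap a b p)
    have "permutation p"
      using fin swap.hyps unfolding permutation_permutes by blast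
    then show ?case
      using swap.IH swap.hyps sign_compose[OF permutation_swap_id, of p a b]
        sign_compose[OF permutation_swap_id, of "shift_perm p" "Suc a" "Suc b"]
        permutation_compose[OF permutation_swap_id, of "shift_perm p" "Suc a" "Suc b"]
      unfolding shift_perm_transpose_comp by (simp add: sign_swap_id del: o_apply)
  qed
qed

text \<open>The cycle \<open>1 \<mapsto> 2 \<mapsto> \<dots> \<mapsto> j + 1 \<mapsto> 1\<close>.\<close>

definition initial_cycle :: "nat \<Rightarrow> nat \<Rightarrow> nat" where
  "initial_cycle j i = (if i = 0 \<or> Suc j < i then i else if i = Suc j then 1 else Suc i)"

lemma initial_cycle_permutation_sign:
  "permutation (initial_cycle j) \<and> sign (initial_cycle j) = (-1) ^ j"
proof (induction j)
  case 0
  have "initial_cycle 0 = id"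
    by (auto simp: initial_cycle_def fun_eq_iff)
  then show ?case by simp
next
  case (Suc j)
  have "initial_cycle (Suc j) = initial_cycle j \<circ> transpose (Suc j) (Suc (Suc j))"
    by (auto simp: initial_cycle_def fun_eq_iff transpose_def)
  then show ?case
    using Suc permutation_compose[of "initial_cycle j" "transpose (Suc j) (Suc (Suc j))"]
      sign_compose[of "initial_cycle j" "transpose (Suc j) (Suc (Suc j))"]
    by (simp add: permutation_swap_id sign_swap_id del: o_apply)
qed

lemma sign_shuffle_perm_Suc_image:
  assumes "A \<subseteq> {1..n}"
  shows "sign (shuffle_perm (Suc n) (Suc ` A)) = sign (shuffle_perm n A)"
proof -
  have fin: "finite A" using assms finite_subset by blast
  let ?w = "sorted_list_of_set ({1..n} - A) @ sorted_list_of_set A"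
  have len: "length ?w = n"
    using assms fin card_mono[OF _ assms] by (simp add: card_Diff_subset)
  have word: "sorted_list_of_set ({1..Suc n} - Suc ` A) @ sorted_list_of_set (Suc ` A) =
      1 # map Suc ?w"
    unfolding atLeastAtMost_Suc_diff_Suc_image[OF assms]
    using fin by (subst sorted_list_of_set_insert_1_Suc_image)
      (auto simp: sorted_list_of_set_Suc_image)
  have "shuffle_perm (Suc n) (Suc ` A) = shift_perm (shuffle_perm n A)"
  proof
    fix i
    show "shuffle_perm (Suc n) (Suc ` A) i = shift_perm (shuffle_perm n A) i"
      unfolding shuffle_perm_def[of "Suc n"] word
      using len
      by (auto simp: shift_perm_def shuffle_perm_def nth_Cons simp del: map_append
          split: nat.split)
  qed
  then show ?thesis
    using shift_perm_permutation_sign permutes_imp_permutation[OF _ shuffle_perm_permutes[OF assms]]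
    by simp
qed

text \<open>
  Compared with the shuffle of the shifted set, the entry \<open>1\<close> sits behind the entries of the
  complement instead of in front of them; moving it there is a cycle of positions.
\<close>

lemma sign_shuffle_perm_insert_1_Suc_image:
  assumes "A \<subseteq> {1..n}"
  shows "sign (shuffle_perm (Suc n) (insert 1 (Suc ` A))) =
    (-1) ^ (n - card A) * sign (shuffle_perm n A)"
proof -
  have fin: "finite A" using assms finite_subset by blast
  let ?B = "sorted_list_of_set ({1..n} - A)"
  have lenB: "length ?B = n - card A"
    using assms fin by (simp add: card_Diff_subset)
  have cardA: "card A \<le> n"
    using card_mono[OF _ assms] by simp
  have len: "length (sorted_list_of_set A) = card A" by simp
  have word: "sorted_list_of_set ({1..Suc n} - insert 1 (Suc ` A)) @
      sorted_list_of_set (insert 1 (Suc ` A)) = map Suc ?B @ 1 # map Suc (sorted_list_of_set A)"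
    unfolding atLeastAtMost_Suc_diff_insert_1_Suc_image
    using assms fin by (subst sorted_list_of_set_insert_1_Suc_image)
      (auto simp: sorted_list_of_set_Suc_image)
  have "shuffle_perm (Suc n) (insert 1 (Suc ` A)) =
      shift_perm (shuffle_perm n A) \<circ> initial_cycle (n - card A)"
  proof
    fix i
    show "shuffle_perm (Suc n) (insert 1 (Suc ` A)) i =
        (shift_perm (shuffle_perm n A) \<circ> initial_cycle (n - card A)) i"
      unfolding shuffle_perm_def[of "Suc n"] word
      using lenB len cardA
      by (cases i) (auto simp: shift_perm_def shuffle_perm_def initial_cycle_def nth_append
          nth_Cons intro!: arg_cong[where f = "(!) (sorted_list_of_set A)"] split: nat.split)
  qed
  moreover have "permutation (shuffle_perm n A)"
    by (rule permutes_imp_permutation[OF _ shuffle_perm_permutes[OF assms]]) simp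
  ultimately show ?thesis
    using shift_perm_permutation_sign[of "shuffle_perm n A"]
      initial_cycle_permutation_sign[of "n - card A"]
    by (simp add: sign_compose)
qed

section \<open>Faces of a point with a distinguished first coordinate\<close>

definition cons_pair :: "'a \<times> 'a list \<Rightarrow> 'a list" where
  "cons_pair z = fst z # snd z"

lemma face0_Suc_cons_pair: "1 \<le> i \<Longrightarrow> face0 (Suc i) (cons_pair z) = cons_pair (face0_coeff i z)"
  by (cases i) (auto simp: cons_pair_def face0_def face0_coeff_def split: prod.split)

lemma face1_Suc_cons_pair:
  "1 \<le> i \<Longrightarrow> face1 ast (Suc i) (cons_pair z) = cons_pair (face1_coeff ast i z)"
  by (cases i) (auto simp: cons_pair_def face1_def face1_coeff_def split: prod.split)

lemma face0_1_cons_pair: "face0 1 (cons_pair z) = snd z"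
  by (simp add: cons_pair_def face0_def)

lemma face1_1_cons_pair: "face1 ast 1 (cons_pair z) = snd z"
  by (simp add: cons_pair_def face1_def)

lemma iterated_face_Suc_image:
  assumes "finite A" "0 \<notin> A"
    and shift: "\<And>i z. 1 \<le> i \<Longrightarrow> \<delta> (Suc i) (\<phi> z) = \<phi> (\<delta>' i z)"
  shows "iterated_face \<delta> (Suc ` A) (\<phi> z) = \<phi> (iterated_face \<delta>' A z)"
proof -
  have "foldr \<delta> (map Suc is) (\<phi> z) = \<phi> (foldr \<delta>' is z)" if "0 \<notin> set is" for "is"
    using that by (induction "is") (auto intro!: shift simp: Suc_le_eq)
  then show ?thesis
    using assms by (simp add: iterated_face_def sorted_list_of_set_Suc_image)
qed

text \<open>The index \<open>1\<close> is the smallest one, so its face map acts last.\<close>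

lemma iterated_face_insert_1_Suc_image:
  assumes "finite A" "0 \<notin> A"
    and "\<And>i z. 1 \<le> i \<Longrightarrow> \<delta> (Suc i) (\<phi> z) = \<phi> (\<delta>' i z)"
  shows "iterated_face \<delta> (insert 1 (Suc ` A)) (\<phi> z) = \<delta> 1 (\<phi> (iterated_face \<delta>' A z))"
proof -
  have "iterated_face \<delta> (insert 1 (Suc ` A)) (\<phi> z) = \<delta> 1 (iterated_face \<delta> (Suc ` A) (\<phi> z))"
    unfolding iterated_face_def sorted_list_of_set_insert_1_Suc_image[OF assms(1,2)]
      sorted_list_of_set_Suc_image[OF assms(1)] by simp
  then show ?thesis
    using iterated_face_Suc_image[of A \<delta> \<phi> \<delta>'] assms by simp
qed

lemmas iterated_face0_Suc_image =
    iterated_face_Suc_image[where \<delta> = face0 and \<phi> = cons_pair and \<delta>' = face0_coeff,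
      OF _ _ face0_Suc_cons_pair]
  and iterated_face1_Suc_image =
    iterated_face_Suc_image[where \<delta> = "face1 ast" and \<phi> = cons_pair
      and \<delta>' = "face1_coeff ast" for ast, OF _ _ face1_Suc_cons_pair]

lemmas iterated_face0_insert_1_Suc_image =
    iterated_face_insert_1_Suc_image[where \<delta> = face0 and \<phi> = cons_pair and \<delta>' = face0_coeff,
      OF _ _ face0_Suc_cons_pair, unfolded face0_1_cons_pair]
  and iterated_face1_insert_1_Suc_image =
    iterated_face_insert_1_Suc_image[where \<delta> = "face1 ast" and \<phi> = cons_pair
      and \<delta>' = "face1_coeff ast" for ast,
      OF _ _ face1_Suc_cons_pair, unfolded face1_1_cons_pair]

text \<open>
  The largest index acts first, so that the remaining indices are still at most the remaining
  degree.
\<close>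

lemma iterated_face_in:
  assumes face: "\<And>i n z. 1 \<le> i \<Longrightarrow> i \<le> Suc n \<Longrightarrow> z \<in> D (Suc n) \<Longrightarrow> \<delta> i z \<in> D n"
    and "A \<subseteq> {1..n}" and "z \<in> D n"
  shows "iterated_face \<delta> A z \<in> D (n - card A)"
proof -
  have "foldr \<delta> is z \<in> D (n - length is)" if "sorted_wrt (<) is" "set is \<subseteq> {1..n}" for "is"
    using that
  proof (induction "is")
    case Nil
    then show ?case using assms by simp
  next
    case (Cons a "is")
    have "set is \<subseteq> {Suc a..n}"
      using Cons.prems by (auto simp: Suc_le_eq subset_iff)
    moreover have "distinct is"
      using Cons.prems strict_sorted_iff by auto
    ultimately have "length is \<le> n - a"
      using card_mono[of "{Suc a..n}" "set is"] by (simp add: distinct_card)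
    moreover have "1 \<le> a" "a \<le> n"
      using Cons.prems by auto
    ultimately have eq: "n - length is = Suc (n - length (a # is))" "a \<le> n - length is"
      by auto
    have "foldr \<delta> is z \<in> D (n - length is)"
      using Cons by auto
    then show ?case
      using face[of a "n - length (a # is)" "foldr \<delta> is z"] eq \<open>1 \<le> a\<close> by simp
  qed
  from this[of "sorted_list_of_set A"] show ?thesis
    using assms(2) finite_subset[OF assms(2)]
    by (simp add: iterated_face_def)
qed

lemma face0_coeff_in:
  assumes "1 \<le> i" "i \<le> Suc n" "z \<in> X \<times> tuples X (Suc n)"
  shows "face0_coeff i z \<in> X \<times> tuples X n"
proof -
  obtain y xs where z: "z = (y, xs)" by (cases z)
  then show ?thesis
    using assms in_set_takeD[of _ "i - 1" xs] in_set_dropD[of _ i xs]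
    by (auto simp: face0_coeff_def face0_def tuples_def)
qed

lemma (in rack) face1_coeff_in:
  assumes "1 \<le> i" "i \<le> Suc n" "z \<in> X \<times> tuples X (Suc n)"
  shows "face1_coeff (\<triangleright>) i z \<in> X \<times> tuples X n"
proof -
  obtain y xs where z: "z = (y, xs)" by (cases z)
  have xs: "y \<in> X" "set xs \<subseteq> X" "length xs = Suc n"
    using assms(3) by (auto simp: z tuples_def)
  then have "xs ! (i - 1) \<in> X"
    using assms(1,2) nth_mem[of "i - 1" xs] by auto
  then show ?thesis
    using xs assms(1,2) closed in_set_takeD[of _ "i - 1" xs] in_set_dropD[of _ i xs]
    by (auto simp: z face1_coeff_def face1_def tuples_def subset_iff)
qed

section \<open>The product of two cochains in the image of \<open>\<psi>\<close>\<close>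

lemma psi_cons_pair:
  "w \<in> X \<times> tuples X k \<Longrightarrow> psi X k F (cons_pair w) = (-1) ^ k * F w"
  by (auto simp: psi_def cons_pair_def tuples_def)

text \<open>
  \<open>P\<close> ignores the distinguished coordinate and has the same sign as \<open>\<psi>\<close>. This is what makes
  \<open>P\<close> appear wherever a face map with index \<open>1\<close> has removed that coordinate.
\<close>

lemma psi_snd_eq_pmap:
  "w \<in> X \<times> tuples X (Suc k) \<Longrightarrow> psi X k F (snd w) = pmap X k F w"
  by (auto simp: psi_def pmap_def)

theorem proposition11:
  fixes X :: "'a set" and ast :: "'a \<Rightarrow> 'a \<Rightarrow> 'a"
    and F G :: "'a \<times> 'a list \<Rightarrow> 'r::comm_ring_1" and k m :: nat
  assumes "rack X ast"
    and "F \<in> cochains_coeff X k"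
    and "G \<in> cochains_coeff X m"
  shows "cup X ast (k + 1) (m + 1) (psi X k F) (psi X m G) =
    (\<lambda>xs\<in>tuples X (k + m + 2).
      psi X (k + m + 1) (cup_coeff X ast k (m + 1) F (pmap X m G)) xs +
      (-1) ^ (k + 1) * psi X (k + m + 1) (cup_coeff X ast (k + 1) m (pmap X k F) G) xs)"
proof -
  define n where "n = k + m + 1"
  define e :: "nat set \<Rightarrow> 'r" where "e A = of_int (sign (shuffle_perm n A))" for A
  have "cup X ast (k + 1) (m + 1) (psi X k F) (psi X m G) v =
      psi X n (cup_coeff X ast k (m + 1) F (pmap X m G)) v +
      (-1) ^ (k + 1) * psi X n (cup_coeff X ast (k + 1) m (pmap X k F) G) v"
    if v: "v \<in> tuples X (Suc n)" for v
  proof -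
    obtain z where z: "z \<in> X \<times> tuples X n" and vz: "v = cons_pair z"
      using v that[of "(hd v, tl v)"] by (cases v) (auto simp: tuples_def cons_pair_def)
    define d0 where "d0 A = iterated_face face0_coeff A z" for A
    define d1 where "d1 A = iterated_face (face1_coeff ast) ({1..n} - A) z" for A
    define S1 where "S1 = (\<Sum>A | A \<subseteq> {1..n} \<and> card A = Suc m. e A * F (d0 A) * pmap X m G (d1 A))"
    define S2 where "S2 = (\<Sum>A | A \<subseteq> {1..n} \<and> card A = m. e A * pmap X k F (d0 A) * G (d1 A))"
    have d0: "d0 A \<in> X \<times> tuples X (n - card A)" if "A \<subseteq> {1..n}" for A
      unfolding d0_def
      by (rule iterated_face_in[where D = "\<lambda>n. X \<times> tuples X n"])
        (use that z in \<open>auto intro: face0_coeff_in\<close>)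
    have d1: "d1 A \<in> X \<times> tuples X (card A)" if "A \<subseteq> {1..n}" for A
    proof -
      have "n - card ({1..n} - A) = card A"
        using that card_mono[OF _ that] finite_subset[OF that] by (simp add: card_Diff_subset)
      moreover have "d1 A \<in> X \<times> tuples X (n - card ({1..n} - A))"
        unfolding d1_def
        by (rule iterated_face_in[where D = "\<lambda>n. X \<times> tuples X n"])
          (use z in \<open>auto intro: rack.face1_coeff_in[OF assms(1)]\<close>)
      ultimately show ?thesis by simp
    qed
    (* the term of A in the product of psi F and psi G *)
    define h where "h A = of_int (sign (shuffle_perm (Suc n) A)) *
        psi X k F (iterated_face face0 A v) *
        psi X m G (iterated_face (face1 ast) ({1..Suc n} - A) v)" for A
    have h1: "h (Suc ` A) = (-1) ^ k * (e A * F (d0 A) * pmap X m G (d1 A))"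
      if A: "A \<subseteq> {1..n}" "card A = Suc m" for A
    proof -
      have fin: "finite A" "0 \<notin> A" using A finite_subset by auto
      have "iterated_face face0 (Suc ` A) v = cons_pair (d0 A)"
        unfolding vz d0_def by (rule iterated_face0_Suc_image[OF fin])
      moreover have "iterated_face (face1 ast) ({1..Suc n} - Suc ` A) v = snd (d1 A)"
        unfolding vz d1_def atLeastAtMost_Suc_diff_Suc_image[OF A(1)]
        by (rule iterated_face1_insert_1_Suc_image) auto
      moreover have "d0 A \<in> X \<times> tuples X k" "d1 A \<in> X \<times> tuples X (Suc m)"
        using d0[OF A(1)] d1[OF A(1)] A(2) by (simp_all add: n_def)
      ultimately show ?thesis
        unfolding h_def e_def sign_shuffle_perm_Suc_image[OF A(1)]
        by (simp add: psi_cons_pair psi_snd_eq_pmap)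
    qed
    have h2: "h (insert 1 (Suc ` A)) =
        (-1) ^ (k + 1) * (-1) ^ m * (e A * pmap X k F (d0 A) * G (d1 A))"
      if A: "A \<subseteq> {1..n}" "card A = m" for A
    proof -
      have fin: "finite A" "0 \<notin> A" using A finite_subset by auto
      have "iterated_face face0 (insert 1 (Suc ` A)) v = snd (d0 A)"
        unfolding vz d0_def by (rule iterated_face0_insert_1_Suc_image[OF fin])
      moreover have "iterated_face (face1 ast) ({1..Suc n} - insert 1 (Suc ` A)) v =
          cons_pair (d1 A)"
        unfolding vz d1_def atLeastAtMost_Suc_diff_insert_1_Suc_image
        by (rule iterated_face1_Suc_image) auto
      moreover have "d0 A \<in> X \<times> tuples X (Suc k)" "d1 A \<in> X \<times> tuples X m"
        using d0[OF A(1)] d1[OF A(1)] A(2) by (simp_all add: n_def)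
      moreover have "n - card A = k + 1"
        using A(2) by (simp add: n_def)
      ultimately show ?thesis
        unfolding h_def e_def sign_shuffle_perm_insert_1_Suc_image[OF A(1)]
        by (simp add: psi_cons_pair psi_snd_eq_pmap)
    qed
    have deg: "k + 1 + (m + 1) = Suc n" "k + (m + 1) = n" "k + 1 + m = n"
      by (simp_all add: n_def)
    have "cup X ast (k + 1) (m + 1) (psi X k F) (psi X m G) v =
        (-1) ^ ((k + 1) * (m + 1)) * (\<Sum>A | A \<subseteq> {1..Suc n} \<and> card A = Suc m. h A)"
      using v unfolding cup_def cup_on_def deg h_def by simp
    also have "(\<Sum>A | A \<subseteq> {1..Suc n} \<and> card A = Suc m. h A) =
        (-1) ^ k * S1 + (-1) ^ (k + 1) * (-1) ^ m * S2"
      unfolding sum_subsets_card_Suc S1_def S2_def sum_distrib_left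
      by (intro arg_cong2[where f = "(+)"] sum.cong refl h1 h2) auto
    finally have lhs: "cup X ast (k + 1) (m + 1) (psi X k F) (psi X m G) v =
        (-1) ^ ((k + 1) * (m + 1)) * ((-1) ^ k * S1 + (-1) ^ (k + 1) * (-1) ^ m * S2)" .
    have rhs1: "psi X n (cup_coeff X ast k (m + 1) F (pmap X m G)) v =
        (-1) ^ n * ((-1) ^ (k * (m + 1)) * S1)"
      unfolding vz psi_cons_pair[OF z]
      using z unfolding cup_coeff_def cup_on_def deg S1_def e_def d0_def d1_def by simp
    have rhs2: "psi X n (cup_coeff X ast (k + 1) m (pmap X k F) G) v =
        (-1) ^ n * ((-1) ^ ((k + 1) * m) * S2)"
      unfolding vz psi_cons_pair[OF z]
      using z unfolding cup_coeff_def cup_on_def deg S2_def e_def d0_def d1_def by simp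
    have sign: "(-1::'r) ^ i = (-1) ^ j" if "even i = even j" for i j :: nat
      using that by (cases "even i") auto
    have "(-1::'r) ^ ((k + 1) * (m + 1)) * (-1) ^ k = (-1) ^ n * (-1) ^ (k * (m + 1))"
      unfolding power_add[symmetric] by (rule sign) (auto simp: n_def)
    moreover have "(-1::'r) ^ ((k + 1) * (m + 1)) * ((-1) ^ (k + 1) * (-1) ^ m) =
        (-1) ^ (k + 1) * ((-1) ^ n * (-1) ^ ((k + 1) * m))"
      unfolding power_add[symmetric] by (rule sign) (auto simp: n_def)
    ultimately show ?thesis
      unfolding lhs rhs1 rhs2 distrib_left mult.assoc[symmetric] by simp
  qed
  moreover have "cup X ast (k + 1) (m + 1) (psi X k F) (psi X m G) v = undefined"
    if "v \<notin> tuples X (Suc n)" for v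
    using that by (simp add: cup_def cup_on_def n_def)
  ultimately show ?thesis
    by (auto simp: fun_eq_iff restrict_def n_def)
qed

end
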